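(* Let $n\ge 2$ and let $t$ be a non-zero complex number. The representation $\hat{\phi}_B(t): C_n\to GL_{n-1}(\mathbb{C})$ is irreducible.
   Context: Let $\mathbb{F}_n$ be the free group on $x_1,\ldots,x_n$. The group $C_n$ of conjugating automorphisms is the subgroup of $\mathrm{Aut}(\mathbb{F}_n)$ of all automorphisms $\phi$ such that $\phi(x_i)=f_i^{-1}x_{\Pi(i)}f_i$ for all $i$, for some permutation $\Pi$ of $\{1,\ldots,n\}$ and some $f_i\in\mathbb{F}_n$. It is generated by the automorphisms $\epsilon_{ij}$, $1\le i\ne j\le n$, where $\epsilon_{ij}(x_i)=x_j^{-1}x_ix_j$ and $\epsilon_{ij}(x_l)=x_l$ for $l\ne i$, together with $\alpha_i$, $1\le i\le n-1$, where $\alpha_i$ swaps $x_i$ and $x_{i+1}$ and fixes the other generators. Products of automorphisms are taken in the right-action convention: $\phi\psi$ means first apply $\phi$, then $\psi$. For a non-zero complex number $t$, let $\hat{\rho}_B:C_n\to GL_n(\mathbb{C})$ be the homomorphism such that: for $i\ne j$, $\hat{\rho}_B(\epsilon_{ij})$ is the matrix that agrees with the identity matrix except in row $i$, where the $(i,i)$ entry is $t^{-1}$, the $(i,j)$ entry is $1-t^{-1}$, and all other entries are $0$; and $\hat{\rho}_B(\alpha_i)$ is the permutation matrix of the transposition $(i\ \ i+1)$. (These assignments do define a homomorphism.) The matrices act on column vectors from the left. The vector $v=[1,\ldots,1]^T$ is fixed by $\hat{\rho}_B(C_n)$. $\hat{\phi}_B(t)$ is the degree $n-1$ composition factor given by the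 induced action of $C_n$ on $\mathbb{C}^n/\langle v\rangle$, written in the basis of the images of the standard basis vectors $e_1,\ldots,e_{n-1}$ (again denoted $e_k$). Explicitly: - for $i\ne j$ with $i,j\le n-1$: $\epsilon_{ij}(e_i)=t^{-1}e_i$, $\epsilon_{ij}(e_j)=e_j+(1-t^{-1})e_i$, and $\epsilon_{ij}(e_k)=e_k$ for $k\ne i,j$; - for $i\le n-1$: $\epsilon_{in}(e_i)=t^{-1}e_i$ and $\epsilon_{in}(e_k)=e_k$ for $k\ne i$; - for $j\le n-1$: $\epsilon_{nj}(e_j)=t^{-1}e_j+\sum_{1\le k\le n-1,\,k\neq j}(t^{-1}-1)e_k$ and $\epsilon_{nj}(e_k)=e_k$ for $k\ne j$; - for $i\le n-2$: $\alpha_i$ swaps $e_i$ and $e_{i+1}$ and fixes the other $e_k$; $\alpha_{n-1}(e_{n-1})=-e_1-\cdots-e_{n-1}$ and $\alpha_{n-1}(e_k)=e_k$ for $k\le n-2$. Irreducible means that the only subspaces of the representation space invariant under the whole group are $0$ and the whole space. *)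

theory Defs
  imports
    "Jordan_Normal_Form.VS_Connect"
    "HOL-Algebra.Bij"
    "HOL-Combinatorics.Permutations"
begin

text \<open>
  All indices are shifted by one: generators, basis vectors and matrix entries are
  numbered from \<open>0\<close> to \<open>n - 1\<close>.
\<close>

section \<open>Free groups\<close>

text \<open>
  The letters \<open>(i, True)\<close> and \<open>(i, False)\<close> stand for \<open>x\<^sub>i\<close> and its inverse.  The elements of the
  free group are the reduced words; the product is concatenation followed by free reduction,
  performed by multiplying the letters of the first word onto the second one by one.
\<close>

type_synonym letter = "nat \<times> bool"

definition inv_letter :: "letter \<Rightarrow> letter" where
  "inv_letter a = (fst a, \<not> snd a)"

definition reduced :: "letter list \<Rightarrow> bool" where
  "reduced w \<longleftrightarrow> successively (\<lambda>a b. b \<noteq> inv_letter a) w"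

definition letter_mult :: "letter \<Rightarrow> letter list \<Rightarrow> letter list" where
  "letter_mult a w = (case w of [] \<Rightarrow> [a] | b # v \<Rightarrow> if b = inv_letter a then v else a # w)"

definition free_group :: "nat \<Rightarrow> letter list monoid" where
  "free_group n =
    \<lparr>carrier = {w. set w \<subseteq> {..<n} \<times> UNIV \<and> reduced w},
     mult = foldr letter_mult,
     one = []\<rparr>"

definition gen :: "nat \<Rightarrow> letter list" where
  "gen i = [(i, True)]"

text \<open>The homomorphism out of the free group sending \<open>x\<^sub>i\<close> to \<open>f i\<close>.\<close>

definition free_ext :: "('g, 'z) monoid_scheme \<Rightarrow> (nat \<Rightarrow> 'g) \<Rightarrow> letter list \<Rightarrow> 'g" where
  "free_ext G f w =
    foldr (\<lambda>a g. (if snd a then f (fst a) else inv\<^bsub>G\<^esub> (f (fst a))) \<otimes>\<^bsub>G\<^esub> g) w \<one>\<^bsub>G\<^esub>"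

definition free_endo :: "nat \<Rightarrow> (nat \<Rightarrow> letter list) \<Rightarrow> letter list \<Rightarrow> letter list" where
  "free_endo n f = restrict (free_ext (free_group n) f) (carrier (free_group n))"


section \<open>Conjugating automorphisms\<close>

definition conj_auts :: "nat \<Rightarrow> (letter list \<Rightarrow> letter list) set" where
  "conj_auts n = {\<phi> \<in> auto (free_group n).
     \<exists>\<pi> f. \<pi> permutes {..<n} \<and> f \<in> {..<n} \<rightarrow> carrier (free_group n) \<and>
       (\<forall>i<n. \<phi> (gen i) =
          inv\<^bsub>free_group n\<^esub> (f i) \<otimes>\<^bsub>free_group n\<^esub> gen (\<pi> i) \<otimes>\<^bsub>free_group n\<^esub> f i)}"

text \<open>
  Automorphisms act from the right (\<open>\<phi> \<otimes> \<psi>\<close> is first \<open>\<phi>\<close>, then \<open>\<psi>\<close>), opposite to the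
  product of \<^const>\<open>AutoGroup\<close>.
\<close>

definition conj_aut_group :: "nat \<Rightarrow> (letter list \<Rightarrow> letter list) monoid" where
  "conj_aut_group n =
    \<lparr>carrier = conj_auts n,
     mult = (\<lambda>\<phi> \<psi>. \<psi> \<otimes>\<^bsub>AutoGroup (free_group n)\<^esub> \<phi>),
     one = \<one>\<^bsub>AutoGroup (free_group n)\<^esub>\<rparr>"

definition eps :: "nat \<Rightarrow> nat \<Rightarrow> nat \<Rightarrow> letter list \<Rightarrow> letter list" where
  "eps n i j = free_endo n (\<lambda>l.
     if l = i then inv\<^bsub>free_group n\<^esub> (gen j) \<otimes>\<^bsub>free_group n\<^esub> gen i \<otimes>\<^bsub>free_group n\<^esub> gen j
     else gen l)"

definition alpha :: "nat \<Rightarrow> nat \<Rightarrow> letter list \<Rightarrow> letter list" where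
  "alpha n i = free_endo n (\<lambda>l. gen (Transposition.transpose i (Suc i) l))"


section \<open>The representations\<close>

definition GL :: "nat \<Rightarrow> complex mat monoid" where
  "GL n = units_of (ring_mat TYPE(complex) n ())"

definition eps_mat :: "nat \<Rightarrow> complex \<Rightarrow> nat \<Rightarrow> nat \<Rightarrow> complex mat" where
  "eps_mat n t i j = mat n n (\<lambda>(r, c).
     if r = i then (if c = i then inverse t else if c = j then 1 - inverse t else 0)
     else if r = c then 1 else 0)"

definition alpha_mat :: "nat \<Rightarrow> nat \<Rightarrow> complex mat" where
  "alpha_mat n i = mat n n (\<lambda>(r, c). if r = Transposition.transpose i (Suc i) c then 1 else 0)"

definition is_rho_B :: "nat \<Rightarrow> complex \<Rightarrow> ((letter list \<Rightarrow> letter list) \<Rightarrow> complex mat) \<Rightarrow> bool" where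
  "is_rho_B n t \<rho> \<longleftrightarrow>
     \<rho> \<in> hom (conj_aut_group n) (GL n) \<and>
     (\<forall>i<n. \<forall>j<n. i \<noteq> j \<longrightarrow> \<rho> (eps n i j) = eps_mat n t i j) \<and>
     (\<forall>i. Suc i < n \<longrightarrow> \<rho> (alpha n i) = alpha_mat n i)"

text \<open>
  The coordinates of the class of \<open>w\<close> in the quotient of \<open>\<complex>\<^sup>n\<close> by the span of \<open>v = (1, \<dots>, 1)\<close>,
  with respect to the classes of the first \<open>n - 1\<close> standard basis vectors;
  see \<open>quot_coords_iff\<close> below.
\<close>

definition quot_coords :: "nat \<Rightarrow> complex vec \<Rightarrow> complex vec" where
  "quot_coords n w = vec (n - 1) (\<lambda>k. w $ k - w $ (n - 1))"

text \<open>
  The induced action on this quotient: the columns of \<open>phi_B n \<rho> g\<close> are the coordinates of the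
  classes of \<open>\<rho> g e\<^sub>k\<close>.
\<close>

definition phi_B :: "nat \<Rightarrow> ('g \<Rightarrow> complex mat) \<Rightarrow> 'g \<Rightarrow> complex mat" where
  "phi_B n \<rho> g =
     mat_of_cols (n - 1) (map (\<lambda>k. quot_coords n (\<rho> g *\<^sub>v unit_vec n k)) [0..<n - 1])"

definition irreducible_rep :: "('g, 'z) monoid_scheme \<Rightarrow> nat \<Rightarrow> ('g \<Rightarrow> complex mat) \<Rightarrow> bool" where
  "irreducible_rep G m \<phi> \<longleftrightarrow>
     (\<forall>W. VectorSpace.subspace class_ring W (module_vec TYPE(complex) m) \<and>
          (\<forall>g\<in>carrier G. \<forall>w\<in>W. \<phi> g *\<^sub>v w \<in> W)
        \<longrightarrow> W = {0\<^sub>v m} \<or> W = carrier_vec m)"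


section \<open>Basic properties\<close>

subsection \<open>The free group and its universal property\<close>

lemma inv_letter_inv_letter [simp]: "inv_letter (inv_letter a) = a"
  by (simp add: inv_letter_def)

lemma inv_letter_neq [simp]: "inv_letter a \<noteq> a" "a \<noteq> inv_letter a"
  by (auto simp: inv_letter_def prod_eq_iff)

lemma reduced_simps [simp]:
  "reduced []" "reduced [a]"
  "reduced (a # b # w) \<longleftrightarrow> b \<noteq> inv_letter a \<and> reduced (b # w)"
  by (auto simp: reduced_def)

lemma reduced_tl: "reduced (a # w) \<Longrightarrow> reduced w"
  by (cases w) auto

lemma letter_mult_reduced: "reduced w \<Longrightarrow> reduced (letter_mult a w)"
  by (cases w) (auto simp: letter_mult_def dest: reduced_tl)

lemma letter_mult_cancel: "reduced w \<Longrightarrow> letter_mult a (letter_mult (inv_letter a) w) = w"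
  by (cases w; cases "tl w") (auto simp: letter_mult_def)

lemma letter_mult_cancel': "reduced w \<Longrightarrow> letter_mult (inv_letter a) (letter_mult a w) = w"
  using letter_mult_cancel[of w "inv_letter a"] by simp

lemma letter_mult_Cons: "reduced (a # w) \<Longrightarrow> letter_mult a w = a # w"
  by (cases w) (auto simp: letter_mult_def)

lemma foldr_reduced: "reduced v \<Longrightarrow> reduced (foldr letter_mult u v)"
  by (induction u) (auto intro: letter_mult_reduced)

lemma letter_mult_set: "set (letter_mult a w) \<subseteq> insert a (set w)"
  by (cases w) (auto simp: letter_mult_def)

lemma foldr_set: "set (foldr letter_mult u v) \<subseteq> set u \<union> set v"
proof (induction u)
  case (Cons a u)
  then show ?case using letter_mult_set[of a "foldr letter_mult u v"] by auto
qed simp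

lemma foldr_letter_mult:
  assumes "reduced v" "reduced u"
  shows "foldr letter_mult (letter_mult a u) v = letter_mult a (foldr letter_mult u v)"
proof (cases u)
  case (Cons b w)
  have "reduced (foldr letter_mult w v)" using assms(1) by (rule foldr_reduced)
  then show ?thesis using Cons letter_mult_cancel[of "foldr letter_mult w v" a]
    by (auto simp: letter_mult_def[of a "b # w"])
qed (simp add: letter_mult_def)

lemma foldr_assoc:
  assumes "reduced v" "reduced w"
  shows "foldr letter_mult (foldr letter_mult u v) w = foldr letter_mult u (foldr letter_mult v w)"
  using assms by (induction u) (auto simp: foldr_letter_mult foldr_reduced)

lemma foldr_Nil: "reduced u \<Longrightarrow> foldr letter_mult u [] = u"
proof (induction u)
  case (Cons a u)
  then show ?case using reduced_tl[OF Cons.prems] by (simp add: letter_mult_Cons)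
qed simp

lemma foldr_inverse:
  "reduced v \<Longrightarrow> foldr letter_mult (rev (map inv_letter u)) (foldr letter_mult u v) = v"
  by (induction u arbitrary: v) (auto simp: letter_mult_cancel' foldr_reduced)

lemma group_free_group: "group (free_group n)"
proof (rule groupI)
  fix x assume x: "x \<in> carrier (free_group n)"
  let ?y = "foldr letter_mult (rev (map inv_letter x)) []"
  have "set ?y \<subseteq> set (map inv_letter x)" using foldr_set[of "rev (map inv_letter x)" "[]"] by simp
  then have "?y \<in> carrier (free_group n)"
    using x by (fastforce simp: free_group_def foldr_reduced inv_letter_def)
  moreover have "?y \<otimes>\<^bsub>free_group n\<^esub> x = \<one>\<^bsub>free_group n\<^esub>"
    using x foldr_inverse[of "[]" x]
    by (auto simp: free_group_def foldr_assoc foldr_Nil)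
  ultimately show "\<exists>y\<in>carrier (free_group n). y \<otimes>\<^bsub>free_group n\<^esub> x = \<one>\<^bsub>free_group n\<^esub>" by blast
next
  fix x y assume "x \<in> carrier (free_group n)" "y \<in> carrier (free_group n)"
  then show "x \<otimes>\<^bsub>free_group n\<^esub> y \<in> carrier (free_group n)"
    using foldr_set[of x y] by (auto simp: free_group_def foldr_reduced)
qed (auto simp: free_group_def foldr_assoc)

lemma gen_closed [simp]: "i < n \<Longrightarrow> gen i \<in> carrier (free_group n)"
  by (simp add: gen_def free_group_def)

lemma inv_gen:
  assumes "i < n"
  shows "inv\<^bsub>free_group n\<^esub> (gen i) = [(i, False)]"
  using assms
  by (intro group.inv_equality[OF group_free_group])
     (auto simp: gen_def free_group_def letter_mult_def inv_letter_def)

lemma free_ext_Cons: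
  "free_ext G f (a # w) =
    (if snd a then f (fst a) else inv\<^bsub>G\<^esub> (f (fst a))) \<otimes>\<^bsub>G\<^esub> free_ext G f w"
  by (simp add: free_ext_def)

lemma free_ext_hom:
  assumes "group G" and f: "f \<in> {..<n} \<rightarrow> carrier G"
  shows "free_ext G f \<in> hom (free_group n) G"
proof -
  interpret group G by fact
  let ?l = "\<lambda>a :: letter. if snd a then f (fst a) else inv\<^bsub>G\<^esub> (f (fst a))"
  have l: "?l a \<in> carrier G" if "fst a < n" for a using f that by auto
  have cl: "free_ext G f w \<in> carrier G" if "set w \<subseteq> {..<n} \<times> UNIV" for w
    using that
  proof (induction w)
    case (Cons a w)
    then show ?case using l[of a] by (auto simp: free_ext_Cons simp del: split_paired_All)
  qed (simp add: free_ext_def)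
  have lm: "free_ext G f (letter_mult a w) = ?l a \<otimes>\<^bsub>G\<^esub> free_ext G f w"
    if w: "set w \<subseteq> {..<n} \<times> UNIV" and a: "fst a < n" for a w
  proof (cases "\<exists>v. w = inv_letter a # v")
    case True
    then obtain v where v: "w = inv_letter a # v" by blast
    have "f (fst a) \<in> carrier G" using f a by auto
    then have "?l a \<otimes>\<^bsub>G\<^esub> ?l (inv_letter a) = \<one>\<^bsub>G\<^esub>" by (simp add: inv_letter_def)
    moreover have "free_ext G f v \<in> carrier G" using w v by (intro cl) auto
    moreover have "?l a \<in> carrier G" "?l (inv_letter a) \<in> carrier G"
      using a by (intro l; simp add: inv_letter_def)+
    ultimately show ?thesis
      unfolding v letter_mult_def free_ext_Cons by (simp add: m_assoc[symmetric] del: fst_conv snd_conv)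
  next
    case False
    then have "letter_mult a w = a # w" by (auto simp: letter_mult_def split: list.splits)
    then show ?thesis by (simp add: free_ext_Cons)
  qed
  have "free_ext G f (foldr letter_mult u v) = free_ext G f u \<otimes>\<^bsub>G\<^esub> free_ext G f v"
    if "set u \<subseteq> {..<n} \<times> UNIV" "set v \<subseteq> {..<n} \<times> UNIV" for u v
    using that(1)
  proof (induction u)
    case Nil
    then show ?case using cl[OF that(2)] by (simp add: free_ext_def)
  next
    case (Cons a u)
    have "set (foldr letter_mult u v) \<subseteq> {..<n} \<times> UNIV" 
      using foldr_set[of u v] Cons.prems that(2) by auto
    moreover have "fst a < n" using Cons.prems by auto
    ultimately have "free_ext G f (foldr letter_mult (a # u) v) =
       ?l a \<otimes>\<^bsub>G\<^esub> (free_ext G f u \<otimes>\<^bsub>G\<^esub> free_ext G f v)"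
      using Cons lm by simp
    then show ?case using l[OF \<open>fst a < n\<close>] cl[of u] cl[OF that(2)] Cons.prems
      by (simp add: free_ext_Cons m_assoc)
  qed
  then show ?thesis using cl by (auto simp: hom_def free_group_def)
qed

lemma free_ext_gen: "group G \<Longrightarrow> f i \<in> carrier G \<Longrightarrow> free_ext G f (gen i) = f i"
  by (simp add: free_ext_def gen_def group.is_monoid monoid.r_one)

lemma free_hom_unique:
  assumes G: "group G" and h: "h \<in> hom (free_group n) G" and k: "k \<in> hom (free_group n) G"
    and eq: "\<And>i. i < n \<Longrightarrow> h (gen i) = k (gen i)" and w: "w \<in> carrier (free_group n)"
  shows "h w = k w"
  using w
proof (induction w)
  case Nil
  show ?case using hom_one[OF h group_free_group G] hom_one[OF k group_free_group G]
    by (simp add: free_group_def)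
next
  case (Cons a w)
  have w: "w \<in> carrier (free_group n)" and a: "fst a < n" "[a] \<in> carrier (free_group n)"
    using Cons.prems by (auto simp: free_group_def dest: reduced_tl)
  have m: "a # w = [a] \<otimes>\<^bsub>free_group n\<^esub> w"
    using Cons.prems by (simp add: free_group_def letter_mult_Cons)
  have "h [a] = k [a]"
  proof (cases "snd a")
    case True
    then have "[a] = gen (fst a)" by (simp add: gen_def prod_eq_iff)
    then show ?thesis using eq a by simp
  next
    case False
    then have "[a] = inv\<^bsub>free_group n\<^esub> (gen (fst a))" using a by (simp add: inv_gen prod_eq_iff)
    moreover have "h (inv\<^bsub>free_group n\<^esub> (gen (fst a))) = k (inv\<^bsub>free_group n\<^esub> (gen (fst a)))"
      using group_hom.hom_inv[of "free_group n" G h] group_hom.hom_inv[of "free_group n" G k]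
        G h k a eq group_free_group
      by (simp add: group_hom_def group_hom_axioms_def)
    ultimately show ?thesis by simp
  qed
  then show ?case unfolding m using hom_mult[OF h a(2) w] hom_mult[OF k a(2) w] Cons.IH[OF w] by simp
qed


subsection \<open>The group of conjugating automorphisms\<close>

lemma free_endo_hom:
  assumes "f \<in> {..<n} \<rightarrow> carrier (free_group n)"
  shows "free_endo n f \<in> hom (free_group n) (free_group n)"
  unfolding free_endo_def
  by (rule group.hom_restrict[OF group_free_group free_ext_hom[OF group_free_group assms]]) simp

lemma free_endo_gen:
  assumes "f \<in> {..<n} \<rightarrow> carrier (free_group n)" "i < n"
  shows "free_endo n f (gen i) = f i"
proof -
  have "f i \<in> carrier (free_group n)" using assms by auto
  then show ?thesis using assms by (simp add: free_endo_def free_ext_gen[OF group_free_group])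
qed

lemma free_endo_auto:
  assumes f: "f \<in> {..<n} \<rightarrow> carrier (free_group n)" and g: "g \<in> {..<n} \<rightarrow> carrier (free_group n)"
    and fg: "\<And>i. i < n \<Longrightarrow> free_endo n f (g i) = gen i"
    and gf: "\<And>i. i < n \<Longrightarrow> free_endo n g (f i) = gen i"
  shows "free_endo n f \<in> auto (free_group n)"
proof -
  let ?F = "free_group n"
  have inv: "free_endo n f (free_endo n g w) = w"
    if f: "f \<in> {..<n} \<rightarrow> carrier ?F" and g: "g \<in> {..<n} \<rightarrow> carrier ?F"
      and fg: "\<And>i. i < n \<Longrightarrow> free_endo n f (g i) = gen i" and w: "w \<in> carrier ?F" for f g w
  proof -
    have "(free_endo n f \<circ> free_endo n g) w = (\<lambda>x. x) w"
    proof (rule free_hom_unique[OF group_free_group])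
      show "free_endo n f \<circ> free_endo n g \<in> hom ?F ?F"
        by (rule Group.hom_compose[OF free_endo_hom[OF g] free_endo_hom[OF f]])
      show "(\<lambda>x. x) \<in> hom ?F ?F" by (auto simp: hom_def)
    qed (use w fg free_endo_gen[OF g] in auto)
    then show ?thesis by simp
  qed
  have "free_endo n f \<in> carrier ?F \<rightarrow> carrier ?F" "free_endo n g \<in> carrier ?F \<rightarrow> carrier ?F"
    using free_endo_hom f g by (auto simp: hom_def)
  then have "bij_betw (free_endo n f) (carrier ?F) (carrier ?F)"
    using inv[OF f g fg] inv[OF g f gf] by (intro bij_betwI[of _ _ _ "free_endo n g"]) auto
  moreover have "free_endo n f \<in> extensional (carrier ?F)"
    by (simp add: free_endo_def)
  ultimately show ?thesis using free_endo_hom[OF f] by (simp add: auto_def Bij_def)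
qed

lemma alpha_in_conj_auts:
  assumes i: "Suc i < n"
  shows "alpha n i \<in> conj_auts n"
    and "l < n \<Longrightarrow> alpha n i (gen l) = gen (Transposition.transpose i (Suc i) l)"
proof -
  let ?s = "Transposition.transpose i (Suc i)" and ?F = "free_group n"
  interpret group ?F by (rule group_free_group)
  let ?f = "\<lambda>l. gen (?s l)"
  have s: "?s l < n" if "l < n" for l using i that by (auto simp: Transposition.transpose_def)
  then have f: "?f \<in> {..<n} \<rightarrow> carrier ?F" by auto
  have 1: "alpha n i (gen l) = gen (?s l)" if "l < n" for l
    unfolding alpha_def using free_endo_gen[OF f that] .
  have 2: "alpha n i \<in> auto ?F" unfolding alpha_def
    by (rule free_endo_auto[OF f f]) (simp_all add: free_endo_gen[OF f] s)
  have "?s permutes {..<n}" using i by (intro permutes_swap_id) auto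
  moreover have "\<forall>l<n. alpha n i (gen l) = inv\<^bsub>?F\<^esub> \<one>\<^bsub>?F\<^esub> \<otimes>\<^bsub>?F\<^esub> gen (?s l) \<otimes>\<^bsub>?F\<^esub> \<one>\<^bsub>?F\<^esub>"
    by (simp add: 1 s)
  ultimately show "alpha n i \<in> conj_auts n"
    unfolding conj_auts_def using 2 one_closed
    by (intro CollectI conjI exI[of _ ?s] exI[of _ "\<lambda>_. \<one>\<^bsub>?F\<^esub>"]) auto
  show "l < n \<Longrightarrow> alpha n i (gen l) = gen (?s l)" by (rule 1)
qed

lemma eps_in_conj_auts:
  assumes i: "i < n" and j: "j < n" and ij: "i \<noteq> j"
  shows "eps n i j \<in> conj_auts n"
    and "eps n i j (gen i) =
      inv\<^bsub>free_group n\<^esub> (gen j) \<otimes>\<^bsub>free_group n\<^esub> gen i \<otimes>\<^bsub>free_group n\<^esub> gen j"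
    and "l < n \<Longrightarrow> l \<noteq> i \<Longrightarrow> eps n i j (gen l) = gen l"
proof -
  let ?F = "free_group n"
  interpret group ?F by (rule group_free_group)
  define f where "f = (\<lambda>l. if l = i then inv\<^bsub>?F\<^esub> (gen j) \<otimes>\<^bsub>?F\<^esub> gen i \<otimes>\<^bsub>?F\<^esub> gen j else gen l)"
  define g where "g = (\<lambda>l. if l = i then gen j \<otimes>\<^bsub>?F\<^esub> gen i \<otimes>\<^bsub>?F\<^esub> inv\<^bsub>?F\<^esub> (gen j) else gen l)"
  have f: "f \<in> {..<n} \<rightarrow> carrier ?F" and g: "g \<in> {..<n} \<rightarrow> carrier ?F"
    using i j by (auto simp: f_def g_def)
  have e: "eps n i j = free_endo n f" by (simp add: eps_def f_def)
  interpret hf: group_hom ?F ?F "free_endo n f"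
    using free_endo_hom[OF f] by unfold_locales
  interpret hg: group_hom ?F ?F "free_endo n g"
    using free_endo_hom[OF g] by unfold_locales
  have fi: "f i = inv\<^bsub>?F\<^esub> (gen j) \<otimes>\<^bsub>?F\<^esub> gen i \<otimes>\<^bsub>?F\<^esub> gen j"
    and gi: "g i = gen j \<otimes>\<^bsub>?F\<^esub> gen i \<otimes>\<^bsub>?F\<^esub> inv\<^bsub>?F\<^esub> (gen j)"
    and fl: "\<And>l. l \<noteq> i \<Longrightarrow> f l = gen l" and gl: "\<And>l. l \<noteq> i \<Longrightarrow> g l = gen l"
    by (simp_all add: f_def g_def)
  have c: "gen j \<otimes>\<^bsub>?F\<^esub> (inv\<^bsub>?F\<^esub> gen j \<otimes>\<^bsub>?F\<^esub> x) = x" "inv\<^bsub>?F\<^esub> gen j \<otimes>\<^bsub>?F\<^esub> (gen j \<otimes>\<^bsub>?F\<^esub> x) = x"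
    if "x \<in> carrier ?F" for x
    using that j by (simp_all add: m_assoc[symmetric])
  have 2: "eps n i j \<in> auto ?F" unfolding e
  proof (rule free_endo_auto[OF f g])
    show "free_endo n f (g l) = gen l" if "l < n" for l
      using that i j ij
      by (cases "l = i") (simp_all add: gi gl fi fl free_endo_gen[OF f] m_assoc c)
    show "free_endo n g (f l) = gen l" if "l < n" for l
      using that i j ij
      by (cases "l = i") (simp_all add: gi gl fi fl free_endo_gen[OF g] m_assoc c)
  qed
  have "\<forall>l<n. eps n i j (gen l) = inv\<^bsub>?F\<^esub> (if l = i then gen j else \<one>\<^bsub>?F\<^esub>) \<otimes>\<^bsub>?F\<^esub> gen (id l)
      \<otimes>\<^bsub>?F\<^esub> (if l = i then gen j else \<one>\<^bsub>?F\<^esub>)"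
    unfolding e using free_endo_gen[OF f] by (auto simp: f_def)
  then show "eps n i j \<in> conj_auts n"
    unfolding conj_auts_def using 2 j
    by (intro CollectI conjI exI[of _ id] exI[of _ "\<lambda>l. if l = i then gen j else \<one>\<^bsub>?F\<^esub>"])
       (auto intro: permutes_id)
  show "eps n i j (gen i) = inv\<^bsub>?F\<^esub> (gen j) \<otimes>\<^bsub>?F\<^esub> gen i \<otimes>\<^bsub>?F\<^esub> gen j"
    and "l < n \<Longrightarrow> l \<noteq> i \<Longrightarrow> eps n i j (gen l) = gen l"
    unfolding e using free_endo_gen[OF f] i by (auto simp: f_def)
qed


lemma group_conj_aut_group: "group (conj_aut_group n)"
proof -
  let ?F = "free_group n" and ?C = "conj_aut_group n"
  let ?S = "carrier ?F"
  interpret F: group ?F by (rule group_free_group)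
  interpret A: group "AutoGroup ?F" by (rule F.AutoGroup)
  have cA: "carrier (AutoGroup ?F) = auto ?F" by (simp add: AutoGroup_def)
  have mA: "\<psi> \<otimes>\<^bsub>AutoGroup ?F\<^esub> \<phi> = compose ?S \<psi> \<phi>" if "\<phi> \<in> auto ?F" "\<psi> \<in> auto ?F" for \<phi> \<psi>
    using that by (simp add: AutoGroup_def BijGroup_def auto_def)
  have oA: "\<one>\<^bsub>AutoGroup ?F\<^esub> = (\<lambda>x\<in>?S. x)" by (simp add: AutoGroup_def BijGroup_def)
  have sub: "conj_auts n \<subseteq> auto ?F" by (auto simp: conj_auts_def)
  have gh: "group_hom ?F ?F \<phi>" if "\<phi> \<in> auto ?F" for \<phi>
    using that F.group_axioms by (simp add: group_hom_def group_hom_axioms_def auto_def)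
  have conjI': "\<phi> \<in> conj_auts n" if "\<phi> \<in> auto ?F" "\<pi> permutes {..<n}"
      "\<And>i. i < n \<Longrightarrow> f i \<in> ?S"
      "\<And>i. i < n \<Longrightarrow> \<phi> (gen i) = inv\<^bsub>?F\<^esub> (f i) \<otimes>\<^bsub>?F\<^esub> gen (\<pi> i) \<otimes>\<^bsub>?F\<^esub> f i" for \<phi> \<pi> f
    unfolding conj_auts_def using that by blast
  have mult: "\<psi> \<otimes>\<^bsub>AutoGroup ?F\<^esub> \<phi> \<in> conj_auts n"
    if a: "\<phi> \<in> conj_auts n" and b: "\<psi> \<in> conj_auts n" for \<phi> \<psi>
  proof -
    obtain \<pi> f where p: "\<pi> permutes {..<n}" "f \<in> {..<n} \<rightarrow> ?S"
      "\<And>i. i < n \<Longrightarrow> \<phi> (gen i) = inv\<^bsub>?F\<^esub> (f i) \<otimes>\<^bsub>?F\<^esub> gen (\<pi> i) \<otimes>\<^bsub>?F\<^esub> f i"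
      using a by (auto simp: conj_auts_def)
    obtain \<sigma> h where q: "\<sigma> permutes {..<n}" "h \<in> {..<n} \<rightarrow> ?S"
      "\<And>i. i < n \<Longrightarrow> \<psi> (gen i) = inv\<^bsub>?F\<^esub> (h i) \<otimes>\<^bsub>?F\<^esub> gen (\<sigma> i) \<otimes>\<^bsub>?F\<^esub> h i"
      using b by (auto simp: conj_auts_def)
    interpret \<psi>: group_hom ?F ?F \<psi> using b sub by (blast intro: gh)
    have lt: "\<pi> i < n" "\<sigma> i < n" if "i < n" for i
      using permutes_in_image[OF p(1), of i] permutes_in_image[OF q(1), of i] that by auto
    have fS: "f i \<in> ?S" "h i \<in> ?S" if "i < n" for i using p(2) q(2) that by auto
    show ?thesis
    proof (rule conjI'[of _ "\<sigma> \<circ> \<pi>" "\<lambda>i. h (\<pi> i) \<otimes>\<^bsub>?F\<^esub> \<psi> (f i)"])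
      show "\<psi> \<otimes>\<^bsub>AutoGroup ?F\<^esub> \<phi> \<in> auto ?F" using A.m_closed[unfolded cA] a b sub by blast
      show "\<sigma> \<circ> \<pi> permutes {..<n}" by (rule permutes_compose[OF p(1) q(1)])
      fix i assume i: "i < n"
      show "h (\<pi> i) \<otimes>\<^bsub>?F\<^esub> \<psi> (f i) \<in> ?S" using fS lt i by simp
      have "(\<psi> \<otimes>\<^bsub>AutoGroup ?F\<^esub> \<phi>) (gen i) = \<psi> (\<phi> (gen i))"
        using mA[OF subsetD[OF sub a] subsetD[OF sub b]] i by (simp add: compose_def)
      also have "\<dots> = inv\<^bsub>?F\<^esub> (\<psi> (f i)) \<otimes>\<^bsub>?F\<^esub> \<psi> (gen (\<pi> i)) \<otimes>\<^bsub>?F\<^esub> \<psi> (f i)"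
        using p(3)[OF i] fS(1)[OF i] lt(1)[OF i] by simp
      also have "\<dots> = inv\<^bsub>?F\<^esub> (h (\<pi> i) \<otimes>\<^bsub>?F\<^esub> \<psi> (f i)) \<otimes>\<^bsub>?F\<^esub> gen ((\<sigma> \<circ> \<pi>) i) \<otimes>\<^bsub>?F\<^esub> (h (\<pi> i) \<otimes>\<^bsub>?F\<^esub> \<psi> (f i))"
        using q(3)[OF lt(1)[OF i]] fS(1)[OF i] fS(2)[OF lt(1)[OF i]] lt(2)[OF lt(1)[OF i]]
        by (simp add: F.inv_mult_group F.m_assoc)
      finally show "(\<psi> \<otimes>\<^bsub>AutoGroup ?F\<^esub> \<phi>) (gen i) =
        inv\<^bsub>?F\<^esub> (h (\<pi> i) \<otimes>\<^bsub>?F\<^esub> \<psi> (f i)) \<otimes>\<^bsub>?F\<^esub> gen ((\<sigma> \<circ> \<pi>) i) \<otimes>\<^bsub>?F\<^esub> (h (\<pi> i) \<otimes>\<^bsub>?F\<^esub> \<psi> (f i))" .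
    qed
  qed
  have one: "\<one>\<^bsub>AutoGroup ?F\<^esub> \<in> conj_auts n"
    using A.one_closed[unfolded cA]
    by (rule conjI'[of _ id "\<lambda>_. \<one>\<^bsub>?F\<^esub>"]) (simp_all add: oA permutes_id)
  have inv: "inv\<^bsub>AutoGroup ?F\<^esub> \<phi> \<in> conj_auts n" if a: "\<phi> \<in> conj_auts n" for \<phi>
  proof -
    let ?\<psi> = "inv\<^bsub>AutoGroup ?F\<^esub> \<phi>"
    obtain \<pi> f where p: "\<pi> permutes {..<n}" "f \<in> {..<n} \<rightarrow> ?S"
      "\<And>i. i < n \<Longrightarrow> \<phi> (gen i) = inv\<^bsub>?F\<^esub> (f i) \<otimes>\<^bsub>?F\<^esub> gen (\<pi> i) \<otimes>\<^bsub>?F\<^esub> f i"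
      using a by (auto simp: conj_auts_def)
    let ?\<sigma> = "Hilbert_Choice.inv \<pi>"
    have \<phi>: "\<phi> \<in> auto ?F" using a sub by blast
    then have \<psi>: "?\<psi> \<in> auto ?F" using A.inv_closed cA by blast
    interpret \<psi>: group_hom ?F ?F ?\<psi> using \<psi> by (rule gh)
    have lt: "?\<sigma> i < n" if "i < n" for i
      using permutes_in_image[OF permutes_inv[OF p(1)], of i] that by auto
    have fS: "f i \<in> ?S" if "i < n" for i using p(2) that by auto
    have id: "?\<psi> (\<phi> w) = w" if "w \<in> ?S" for w
      using A.l_inv[of \<phi>] mA[OF \<phi> \<psi>] \<phi> cA oA that by (auto simp: compose_def fun_eq_iff restrict_def split: if_splits)
    show ?thesis
    proof (rule conjI'[OF \<psi> permutes_inv[OF p(1)], of "\<lambda>i. inv\<^bsub>?F\<^esub> (?\<psi> (f (?\<sigma> i)))"])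
      fix i assume i: "i < n"
      let ?k = "?\<sigma> i"
      note k = lt[OF i] and fk = fS[OF lt[OF i]]
      show "inv\<^bsub>?F\<^esub> (?\<psi> (f ?k)) \<in> ?S" using fk by simp
      have "gen i = f ?k \<otimes>\<^bsub>?F\<^esub> \<phi> (gen ?k) \<otimes>\<^bsub>?F\<^esub> inv\<^bsub>?F\<^esub> (f ?k)"
        using p(3)[OF k] fk i permutes_inverses(1)[OF p(1), of i]
        by (simp add: F.m_assoc) (simp add: F.m_assoc[symmetric])
      moreover have "\<phi> (gen ?k) \<in> ?S" using k group_hom.hom_closed[OF gh[OF \<phi>]] by simp
      ultimately have "?\<psi> (gen i) = ?\<psi> (f ?k) \<otimes>\<^bsub>?F\<^esub> gen ?k \<otimes>\<^bsub>?F\<^esub> inv\<^bsub>?F\<^esub> (?\<psi> (f ?k))"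
        using fk id[of "gen ?k"] k by simp
      then show "?\<psi> (gen i) = inv\<^bsub>?F\<^esub> (inv\<^bsub>?F\<^esub> (?\<psi> (f ?k))) \<otimes>\<^bsub>?F\<^esub> gen ?k \<otimes>\<^bsub>?F\<^esub> inv\<^bsub>?F\<^esub> (?\<psi> (f ?k))"
        using fk by simp
    qed
  qed
  have in_A: "\<phi> \<in> carrier (AutoGroup ?F)" if "\<phi> \<in> conj_auts n" for \<phi> using that sub cA by blast
  show ?thesis
  proof (rule groupI)
    fix \<phi> assume \<phi>: "\<phi> \<in> carrier ?C"
    then have "inv\<^bsub>AutoGroup ?F\<^esub> \<phi> \<in> carrier ?C" using inv by (simp add: conj_aut_group_def)
    moreover have "inv\<^bsub>AutoGroup ?F\<^esub> \<phi> \<otimes>\<^bsub>?C\<^esub> \<phi> = \<one>\<^bsub>?C\<^esub>"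
      using \<phi> in_A by (simp add: conj_aut_group_def)
    ultimately show "\<exists>\<psi>\<in>carrier ?C. \<psi> \<otimes>\<^bsub>?C\<^esub> \<phi> = \<one>\<^bsub>?C\<^esub>" by blast
  qed (use mult one in_A in \<open>auto simp: conj_aut_group_def A.m_assoc\<close>)
qed


subsection \<open>Existence of the representation\<close>

text \<open>
  The affine group of the space of functions, with \<open>(s, w)\<close> acting by \<open>u \<mapsto> w + s u\<close>.
  The second component of the image of a word under \<open>x\<^sub>i \<mapsto> (t, e\<^sub>i)\<close> consists of its Fox
  derivatives, evaluated at \<open>x\<^sub>k = t\<close>.
\<close>

definition Aff :: "(complex \<times> (nat \<Rightarrow> complex)) monoid" where
  "Aff = \<lparr>carrier = {p. fst p \<noteq> 0},
     mult = (\<lambda>p q. (fst p * fst q, \<lambda>c. snd p c + fst p * snd q c)),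
     one = (1, \<lambda>_. 0)\<rparr>"

lemma group_Aff: "group Aff"
proof (rule groupI)
  fix p assume "p \<in> carrier Aff"
  then show "\<exists>q\<in>carrier Aff. q \<otimes>\<^bsub>Aff\<^esub> p = \<one>\<^bsub>Aff\<^esub>"
    by (intro bexI[of _ "(inverse (fst p), \<lambda>c. - inverse (fst p) * snd p c)"])
       (auto simp: Aff_def)
qed (auto simp: Aff_def algebra_simps)

lemma inv_Aff:
  assumes "s \<noteq> 0"
  shows "inv\<^bsub>Aff\<^esub> (s, w) = (inverse s, \<lambda>c. - inverse s * w c)"
  using assms by (intro group.inv_equality[OF group_Aff]) (auto simp: Aff_def)

definition Fox :: "complex \<Rightarrow> letter list \<Rightarrow> complex \<times> (nat \<Rightarrow> complex)" where
  "Fox t = free_ext Aff (\<lambda>i. (t, \<lambda>c. if c = i then 1 else 0))"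

lemma Fox_hom: "t \<noteq> 0 \<Longrightarrow> Fox t \<in> hom (free_group n) Aff"
  unfolding Fox_def by (rule free_ext_hom[OF group_Aff]) (simp add: Aff_def)

lemma Fox_gen: "t \<noteq> 0 \<Longrightarrow> Fox t (gen i) = (t, \<lambda>c. if c = i then 1 else 0)"
  unfolding Fox_def by (rule free_ext_gen[OF group_Aff]) (simp add: Aff_def)

definition Fox_mat :: "nat \<Rightarrow> complex \<Rightarrow> (letter list \<Rightarrow> letter list) \<Rightarrow> complex mat" where
  "Fox_mat n t \<phi> = mat n n (\<lambda>(r, c). snd (Fox t (\<phi> (gen r))) c)"

lemma fst_Fox_conj_aut:
  assumes t: "t \<noteq> 0" and \<phi>: "\<phi> \<in> conj_auts n" and i: "i < n"
  shows "fst (Fox t (\<phi> (gen i))) = t"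
proof -
  interpret H: group_hom "free_group n" Aff "Fox t"
    using Fox_hom[OF t] group_free_group group_Aff by (simp add: group_hom_def group_hom_axioms_def)
  obtain \<pi> f where p: "\<pi> permutes {..<n}" "f \<in> {..<n} \<rightarrow> carrier (free_group n)"
    "\<phi> (gen i) = inv\<^bsub>free_group n\<^esub> (f i) \<otimes>\<^bsub>free_group n\<^esub> gen (\<pi> i) \<otimes>\<^bsub>free_group n\<^esub> f i"
    using \<phi> i by (auto simp: conj_auts_def)
  have fi: "f i \<in> carrier (free_group n)" using p(2) i by auto
  have "\<pi> i < n" using permutes_in_image[OF p(1), of i] i by auto
  then have "Fox t (\<phi> (gen i)) =
      inv\<^bsub>Aff\<^esub> (Fox t (f i)) \<otimes>\<^bsub>Aff\<^esub> Fox t (gen (\<pi> i)) \<otimes>\<^bsub>Aff\<^esub> Fox t (f i)"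
    using fi p(3) by simp
  moreover have "fst (Fox t (f i)) \<noteq> 0" using H.hom_closed[OF fi] by (simp add: Aff_def)
  ultimately show ?thesis using t
    by (cases "Fox t (f i)") (simp add: inv_Aff Fox_gen, simp add: Aff_def)
qed

lemma Fox_chain_rule:
  assumes t: "t \<noteq> 0" and \<psi>: "\<psi> \<in> conj_auts n" and w: "w \<in> carrier (free_group n)"
  shows "Fox t (\<psi> w) =
    (fst (Fox t w), \<lambda>c. \<Sum>k<n. snd (Fox t w) k * snd (Fox t (\<psi> (gen k))) c)"
proof -
  let ?F = "free_group n"
  let ?T = "\<lambda>p. (fst p, \<lambda>c. \<Sum>k<n. snd p k * snd (Fox t (\<psi> (gen k))) c)"
  have \<psi>h: "\<psi> \<in> hom ?F ?F" using \<psi> by (simp add: conj_auts_def auto_def)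
  have Th: "?T \<in> hom Aff Aff"
    by (auto simp: hom_def Aff_def sum.distrib sum_distrib_left algebra_simps)
  have "(Fox t \<circ> \<psi>) w = (?T \<circ> Fox t) w"
  proof (rule free_hom_unique[OF group_Aff _ _ _ w])
    show "Fox t \<circ> \<psi> \<in> hom ?F Aff" using \<psi>h Fox_hom[OF t] by (rule Group.hom_compose)
    show "?T \<circ> Fox t \<in> hom ?F Aff" using Fox_hom[OF t] Th by (rule Group.hom_compose)
    show "(Fox t \<circ> \<psi>) (gen i) = (?T \<circ> Fox t) (gen i)" if "i < n" for i
      using fst_Fox_conj_aut[OF t \<psi> that] that t
      by (auto simp: Fox_gen prod_eq_iff fun_eq_iff if_distrib[of "\<lambda>x. x * _"] cong: if_cong)
  qed
  then show ?thesis by simp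
qed

lemma Fox_mat_hom:
  assumes t: "t \<noteq> 0"
  shows "Fox_mat n t \<in> hom (conj_aut_group n) (GL n)"
proof -
  let ?C = "conj_aut_group n" and ?F = "free_group n" and ?R = "ring_mat TYPE(complex) n ()"
  interpret C: group ?C by (rule group_conj_aut_group)
  interpret R: ring ?R by (rule ring_mat)
  have cC: "carrier ?C = conj_auts n" by (simp add: conj_aut_group_def)
  have app: "(\<phi> \<otimes>\<^bsub>?C\<^esub> \<psi>) w = \<psi> (\<phi> w)"
    if "\<phi> \<in> conj_auts n" "\<psi> \<in> conj_auts n" "w \<in> carrier ?F" for \<phi> \<psi> w
    using that by (auto simp: conj_aut_group_def AutoGroup_def BijGroup_def conj_auts_def auto_def compose_def)
  have cl: "\<phi> w \<in> carrier ?F" if "\<phi> \<in> conj_auts n" "w \<in> carrier ?F" for \<phi> w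
    using that by (auto simp: conj_auts_def auto_def hom_def)
  have mult: "Fox_mat n t (\<phi> \<otimes>\<^bsub>?C\<^esub> \<psi>) = Fox_mat n t \<phi> * Fox_mat n t \<psi>"
    if "\<phi> \<in> conj_auts n" "\<psi> \<in> conj_auts n" for \<phi> \<psi>
    using that
    by (intro eq_matI)
       (auto simp: Fox_mat_def app Fox_chain_rule[OF t that(2) cl[OF that(1)]] scalar_prod_def
         atLeast0LessThan)
  have one: "Fox_mat n t \<one>\<^bsub>?C\<^esub> = 1\<^sub>m n"
    using t by (intro eq_matI)
      (auto simp: Fox_mat_def conj_aut_group_def AutoGroup_def BijGroup_def Fox_gen)
  have car: "Fox_mat n t \<phi> \<in> carrier_mat n n" for \<phi> by (simp add: Fox_mat_def)
  have unit: "Fox_mat n t \<phi> \<in> Units ?R" if \<phi>: "\<phi> \<in> conj_auts n" for \<phi>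
  proof -
    have i: "inv\<^bsub>?C\<^esub> \<phi> \<in> conj_auts n" using C.inv_closed \<phi> cC by blast
    have "Fox_mat n t (inv\<^bsub>?C\<^esub> \<phi>) * Fox_mat n t \<phi> = 1\<^sub>m n"
      "Fox_mat n t \<phi> * Fox_mat n t (inv\<^bsub>?C\<^esub> \<phi>) = 1\<^sub>m n"
      using \<phi> i cC one by (simp_all add: mult[symmetric])
    then show ?thesis using car unfolding Units_def ring_mat_simps by blast
  qed
  show ?thesis using unit mult
    by (auto simp: hom_def GL_def units_of_def cC ring_mat_simps)
qed

lemma is_rho_B_exists:
  assumes t: "t \<noteq> 0"
  shows "is_rho_B n t (Fox_mat n t)"
  unfolding is_rho_B_def
proof (intro conjI allI impI)
  interpret H: group_hom "free_group n" Aff "Fox t"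
    using Fox_hom[OF t] group_free_group group_Aff by (simp add: group_hom_def group_hom_axioms_def)
  show "Fox_mat n t \<in> hom (conj_aut_group n) (GL n)" by (rule Fox_mat_hom[OF t])
  show "Fox_mat n t (alpha n i) = alpha_mat n i" if i: "Suc i < n" for i
    using t by (intro eq_matI)
      (auto simp: Fox_mat_def alpha_mat_def alpha_in_conj_auts(2)[OF i] Fox_gen
        Transposition.transpose_def)
  show "Fox_mat n t (eps n i j) = eps_mat n t i j" if ij: "i < n" "j < n" "i \<noteq> j" for i j
  proof -
    have "Fox t (eps n i j (gen i)) = inv\<^bsub>Aff\<^esub> (Fox t (gen j)) \<otimes>\<^bsub>Aff\<^esub> Fox t (gen i) \<otimes>\<^bsub>Aff\<^esub> Fox t (gen j)"
      using ij by (simp add: eps_in_conj_auts(2))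
    then have "snd (Fox t (eps n i j (gen i))) c =
        (if c = i then inverse t else if c = j then 1 - inverse t else 0)" for c
      using t ij by (simp add: Fox_gen inv_Aff) (simp add: Aff_def)
    moreover have "Fox t (eps n i j (gen l)) = (t, \<lambda>c. if c = l then 1 else 0)"
      if "l < n" "l \<noteq> i" for l
      using eps_in_conj_auts(3)[OF ij that] t by (simp add: Fox_gen)
    ultimately show ?thesis
      by (intro eq_matI) (auto simp: Fox_mat_def eps_mat_def)
  qed
qed


subsection \<open>The quotient representation\<close>

lemma quot_coords_iff:
  assumes w: "w \<in> carrier_vec n" and n: "n \<ge> 1" and c: "c \<in> carrier_vec (n - 1)"
  shows "c = quot_coords n w \<longleftrightarrow>
    (\<exists>a. w - vec n (\<lambda>k. if k < n - 1 then c $ k else 0) = a \<cdot>\<^sub>v vec n (\<lambda>_. 1))"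
proof
  assume "c = quot_coords n w"
  then have "w - vec n (\<lambda>k. if k < n - 1 then c $ k else 0) = w $ (n - 1) \<cdot>\<^sub>v vec n (\<lambda>_. 1)"
    using w n by (intro eq_vecI) (auto simp: quot_coords_def dest: Nat.le_imp_diff_is_add
        intro!: arg_cong[of _ _ "\<lambda>k. w $ k"])
  then show "\<exists>a. w - vec n (\<lambda>k. if k < n - 1 then c $ k else 0) = a \<cdot>\<^sub>v vec n (\<lambda>_. 1)" ..
next
  assume "\<exists>a. w - vec n (\<lambda>k. if k < n - 1 then c $ k else 0) = a \<cdot>\<^sub>v vec n (\<lambda>_. 1)"
  then obtain a where a: "w - vec n (\<lambda>k. if k < n - 1 then c $ k else 0) = a \<cdot>\<^sub>v vec n (\<lambda>_. 1)" ..
  have "w $ k - (if k < n - 1 then c $ k else 0) = a" if "k < n" for k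
    using arg_cong[OF a, of "\<lambda>v. v $ k"] that w by simp
  from this[of "n - 1"] this show "c = quot_coords n w"
    using n c by (intro eq_vecI) (auto simp: quot_coords_def algebra_simps)
qed

lemma phi_B_carrier: "phi_B n \<rho> g \<in> carrier_mat (n - 1) (n - 1)"
  by (simp add: phi_B_def mat_of_cols_def)

lemma phi_B_index:
  assumes "\<rho> g \<in> carrier_mat n n" "r < n - 1" "c < n - 1"
  shows "phi_B n \<rho> g $$ (r, c) = \<rho> g $$ (r, c) - \<rho> g $$ (n - 1, c)"
  using assms by (simp add: phi_B_def mat_of_cols_def quot_coords_def)

lemma phi_B_induced:
  assumes A: "\<rho> g \<in> carrier_mat n n" and v: "\<rho> g *\<^sub>v vec n (\<lambda>_. 1) = vec n (\<lambda>_. 1)"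
    and w: "w \<in> carrier_vec n" and n: "n \<ge> 1"
  shows "phi_B n \<rho> g *\<^sub>v quot_coords n w = quot_coords n (\<rho> g *\<^sub>v w)"
proof (rule eq_vecI)
  fix r assume "r < dim_vec (quot_coords n (\<rho> g *\<^sub>v w))"
  then have r: "r < n - 1" by (simp add: quot_coords_def)
  obtain m where m: "n = Suc m" using n by (cases n) auto
  let ?a = "\<lambda>i k. \<rho> g $$ (i, k)"
  have s: "(\<Sum>k<n. ?a i k) = 1" if "i < n" for i
    using arg_cong[OF v, of "\<lambda>v. v $ i"] A that by (simp add: scalar_prod_def atLeast0LessThan)
  have sw: "(\<rho> g *\<^sub>v w) $ i = (\<Sum>k<n. ?a i k * w $ k)" if "i < n" for i
    using A w that by (simp add: scalar_prod_def atLeast0LessThan)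
  have "(phi_B n \<rho> g *\<^sub>v quot_coords n w) $ r = (\<Sum>k<m. (?a r k - ?a m k) * (w $ k - w $ m))"
    using r phi_B_carrier[of n \<rho> g] phi_B_index[of \<rho> g n, OF A r]
    by (simp add: scalar_prod_def atLeast0LessThan m quot_coords_def)
  also have "\<dots> = (\<Sum>k<n. (?a r k - ?a m k) * (w $ k - w $ m))" by (simp add: m)
  also have "\<dots> = (\<Sum>k<n. ?a r k * w $ k) - (\<Sum>k<n. ?a m k * w $ k)
      - ((\<Sum>k<n. ?a r k) - (\<Sum>k<n. ?a m k)) * w $ m"
    by (simp add: algebra_simps sum_subtractf sum.distrib sum_distrib_left)
  also have "\<dots> = quot_coords n (\<rho> g *\<^sub>v w) $ r"
    using r s[of r] s[of m] sw[of r] sw[of m] by (simp add: quot_coords_def m)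
  finally show "(phi_B n \<rho> g *\<^sub>v quot_coords n w) $ r = quot_coords n (\<rho> g *\<^sub>v w) $ r" .
qed (use phi_B_carrier[of n \<rho> g] in \<open>simp add: quot_coords_def\<close>)

lemma phi_B_eps:
  assumes \<rho>: "is_rho_B n t \<rho>" and ij: "i < n" "j < n" "i \<noteq> j"
  shows "phi_B n \<rho> (eps n i j) = mat (n - 1) (n - 1) (\<lambda>(r, c).
    if i < n - 1 then
      (if r = i then (if c = i then inverse t else if c = j then 1 - inverse t else 0)
       else if r = c then 1 else 0)
    else
      (if c = j then (if r = j then inverse t else inverse t - 1)
       else if r = c then 1 else 0))"
proof -
  have e: "\<rho> (eps n i j) = eps_mat n t i j" using \<rho> ij by (simp add: is_rho_B_def)
  then have "\<rho> (eps n i j) \<in> carrier_mat n n" by (simp add: eps_mat_def)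
  from phi_B_index[of \<rho>, OF this] show ?thesis using phi_B_carrier[of n \<rho> "eps n i j"] ij
    by (intro eq_matI) (auto simp: e eps_mat_def)
qed

lemma phi_B_alpha:
  assumes \<rho>: "is_rho_B n t \<rho>" and i: "Suc i < n"
  shows "phi_B n \<rho> (alpha n i) = mat (n - 1) (n - 1) (\<lambda>(r, c).
    if Suc i < n - 1 then (if r = Transposition.transpose i (Suc i) c then 1 else 0)
    else if c = i then -1 else if r = c then 1 else 0)"
proof -
  have e: "\<rho> (alpha n i) = alpha_mat n i" using \<rho> i by (simp add: is_rho_B_def)
  then have "\<rho> (alpha n i) \<in> carrier_mat n n" by (simp add: alpha_mat_def)
  from phi_B_index[of \<rho>, OF this] show ?thesis using phi_B_carrier[of n \<rho> "alpha n i"] i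
    by (intro eq_matI) (auto simp: e alpha_mat_def Transposition.transpose_def)
qed

end

theory Submission
  imports Defs
begin

text \<open>
  Restricted to the automorphisms \<open>\<alpha>\<^sub>i\<close>, the representation is the standard representation of the
  symmetric group, on \<open>\<complex>\<^sup>n\<close> modulo the constant vectors, and this is already irreducible.
  Put \<open>m = n - 1\<close> and number the coordinates from \<open>0\<close> to \<open>m - 1\<close>.  All \<open>\<alpha>\<^sub>i\<close> but the last permute adjacent
  coordinates.  The last one is the reflection sending \<open>w\<close> to \<open>w - w\<^bsub>m-1\<^esub> u\<^bsub>m-1\<^esub>\<close>, where
  \<open>u\<^sub>k = (1, \<dots>, 1) + e\<^sub>k\<close> (\<open>phi_B_alpha_swap\<close>, \<open>phi_B_alpha_last\<close>).

  Let \<open>W\<close> be a nonzero invariant subspace.  Swapping coordinates, one finds a vector of \<open>W\<close> whose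
  last coordinate is nonzero.  Its difference with its reflection is a nonzero multiple of
  \<open>u\<^bsub>m-1\<^esub>\<close>, so \<open>u\<^bsub>m-1\<^esub>\<close> lies in \<open>W\<close>, and further swaps put every \<open>u\<^sub>k\<close> in \<open>W\<close>
  (\<open>swaps_and_reflection_irreducible\<close>).  The \<open>u\<^sub>k\<close> add up to \<open>m + 1\<close> times the all-ones vector.
  In characteristic \<open>0\<close> this puts the all-ones vector in \<open>W\<close>, hence each \<open>e\<^sub>k\<close> too, and \<open>W\<close> is
  everything (\<open>ones_plus_unit_spanning\<close>).
\<close>

lemma subspace_module_vecD:
  assumes "VectorSpace.subspace class_ring W (module_vec TYPE('a :: field) m)"
  shows "W \<subseteq> carrier_vec m" "0\<^sub>v m \<in> W"
    "v \<in> W \<Longrightarrow> w \<in> W \<Longrightarrow> v + w \<in> W" "v \<in> W \<Longrightarrow> a \<cdot>\<^sub>v v \<in> W"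
  using assms
  by (auto simp: VectorSpace.subspace_def submodule_def module_vec_simps)

lemma subspace_module_vec_sum:
  fixes K :: nat
  assumes sub: "VectorSpace.subspace class_ring W (module_vec TYPE('a :: field) m)"
    and f: "\<And>k. k < K \<Longrightarrow> f k \<in> W"
  shows "vec m (\<lambda>r. \<Sum>k<K. c k * f k $ r) \<in> W"
  using f
proof (induction K)
  case 0
  have "vec m (\<lambda>r. \<Sum>k<0. c k * f k $ r) = 0\<^sub>v m" by auto
  then show ?case using subspace_module_vecD(2)[OF sub] by simp
next
  case (Suc K)
  have "f K \<in> carrier_vec m" using Suc.prems subspace_module_vecD(1)[OF sub] by blast
  then have "vec m (\<lambda>r. \<Sum>k<Suc K. c k * f k $ r) = vec m (\<lambda>r. \<Sum>k<K. c k * f k $ r) + c K \<cdot>\<^sub>v f K"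
    by (intro eq_vecI) auto
  then show ?case using Suc subspace_module_vecD(3,4)[OF sub] by simp
qed

text \<open>
  The vector \<open>u\<^sub>k = (1, \<dots>, 1) + e\<^sub>k\<close>.  With \<open>m = n - 1\<close>, in the quotient of the \<open>n\<close>-dimensional
  space by the constant vectors, it is the class of \<open>e\<^sub>k - e\<^bsub>n-1\<^esub>\<close>, where the index
  \<open>n - 1\<close> belongs to the basis vector that the coordinates leave out.  These are the roots
  attached to the transpositions of \<open>k\<close> and \<open>n - 1\<close>.
\<close>

definition ones_plus_unit :: "nat \<Rightarrow> nat \<Rightarrow> 'a :: field_char_0 vec" where
  "ones_plus_unit m k = vec m (\<lambda>r. if r = k then 2 else 1)"

text \<open>
  The matrix with columns \<open>u\<^sub>k\<close> is the identity plus the all-ones matrix, whose determinant is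
  \<open>m + 1\<close>.  Solving for the coefficients of \<open>w\<close> gives \<open>c\<^sub>k = w\<^sub>k - S / (m + 1)\<close> with \<open>S\<close> the sum of
  the coordinates of \<open>w\<close>: then \<open>\<Sum>c\<^sub>k = S / (m + 1)\<close>, and \<open>\<Sum>c\<^sub>k u\<^sub>k\<close> has the \<open>r\<close>-th coordinate
  \<open>(\<Sum>c\<^sub>k) + c\<^sub>r = w\<^sub>r\<close>.
\<close>

lemma ones_plus_unit_spanning:
  fixes W :: "'a :: field_char_0 vec set"
  assumes sub: "VectorSpace.subspace class_ring W (module_vec TYPE('a) m)"
    and u: "\<And>k. k < m \<Longrightarrow> ones_plus_unit m k \<in> W"
  shows "W = carrier_vec m"
proof (intro equalityI subsetI)
  fix w :: "'a vec" assume w: "w \<in> carrier_vec m"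
  define S where "S = (\<Sum>k<m. w $ k)"
  define c where "c = (\<lambda>k. w $ k - S / of_nat (Suc m))"
  have "of_nat (Suc m) \<noteq> (0 :: 'a)" by (rule of_nat_neq_0)
  then have sum_c: "(\<Sum>k<m. c k) = S / of_nat (Suc m)"
    by (simp add: c_def sum_subtractf S_def[symmetric] nonzero_eq_divide_eq) (simp add: field_simps)
  have "vec m (\<lambda>r. \<Sum>k<m. c k * ones_plus_unit m k $ r) = w"
  proof (rule eq_vecI)
    fix r assume "r < dim_vec w"
    then have r: "r < m" using w by simp
    then have "vec m (\<lambda>r. \<Sum>k<m. c k * ones_plus_unit m k $ r) $ r
        = (\<Sum>k<m. c k + (if k = r then c k else 0))"
      unfolding index_vec[OF r] by (intro sum.cong) (auto simp: ones_plus_unit_def)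
    also have "\<dots> = w $ r"
      using r by (simp add: sum.distrib sum_c) (simp add: c_def)
    finally show "vec m (\<lambda>r. \<Sum>k<m. c k * ones_plus_unit m k $ r) $ r = w $ r" .
  qed (use w in simp)
  then show "w \<in> W" using subspace_module_vec_sum[OF sub, of m "ones_plus_unit m" c] u by simp
qed (use subspace_module_vecD(1)[OF sub] in blast)

text \<open>
  The reflection moves every vector along \<open>u\<^sub>l\<close>, by an amount that vanishes exactly when the last
  coordinate does; the swaps provide a vector with nonzero last coordinate and spread \<open>u\<^sub>l\<close> to the
  other \<open>u\<^sub>k\<close>.
\<close>

lemma swaps_and_reflection_irreducible:
  fixes W :: "'a :: field_char_0 vec set"
  assumes sub: "VectorSpace.subspace class_ring W (module_vec TYPE('a) (Suc l))"
    and swap: "\<And>i w. i < l \<Longrightarrow> w \<in> W \<Longrightarrow>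
      vec (Suc l) (\<lambda>r. w $ Transposition.transpose i (Suc i) r) \<in> W"
    and refl: "\<And>w. w \<in> W \<Longrightarrow> w - w $ l \<cdot>\<^sub>v ones_plus_unit (Suc l) l \<in> W"
  shows "W = {0\<^sub>v (Suc l)} \<or> W = carrier_vec (Suc l)"
proof (cases "W \<subseteq> {0\<^sub>v (Suc l)}")
  case True
  then show ?thesis using subspace_module_vecD(2)[OF sub] by blast
next
  case False
  note W = subspace_module_vecD[OF sub]
  obtain w where w: "w \<in> W" "w \<noteq> 0\<^sub>v (Suc l)" using False by blast
  then have "w \<in> carrier_vec (Suc l)" using W(1) by blast
  then obtain k where k: "k \<le> l" "w $ k \<noteq> 0"
    using w(2) by (metis carrier_vecD eq_vecI index_zero_vec less_Suc_eq_le)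
  have "\<exists>w\<in>W. w $ l \<noteq> 0"
    using k w(1)
  proof (induction k arbitrary: w rule: inc_induct)
    case (step k)
    show ?case
      using step.IH[OF _ swap[OF step.hyps(2) step.prems(2)]] step.prems(1) step.hyps(2) by simp
  qed blast
  then obtain v where v: "v \<in> W" "v $ l \<noteq> 0" by blast
  have "v \<in> carrier_vec (Suc l)" using v(1) W(1) by blast
  then have "ones_plus_unit (Suc l) l =
      inverse (v $ l) \<cdot>\<^sub>v (v + (- 1) \<cdot>\<^sub>v (v - v $ l \<cdot>\<^sub>v ones_plus_unit (Suc l) l))"
    using v(2) by (intro eq_vecI) (auto simp: ones_plus_unit_def field_simps)
  also have "\<dots> \<in> W" using v(1) refl W(3,4) by blast
  finally have last: "ones_plus_unit (Suc l) l \<in> W" .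
  have "ones_plus_unit (Suc l) k \<in> W" if "k \<le> l" for k
    using that
  proof (induction k rule: inc_induct)
    case (step k)
    have "vec (Suc l) (\<lambda>r. ones_plus_unit (Suc l) (Suc k) $ Transposition.transpose k (Suc k) r)
        = (ones_plus_unit (Suc l) k :: 'a vec)"
      using step.hyps(2)
      by (intro eq_vecI) (auto simp: ones_plus_unit_def Transposition.transpose_def)
    then show ?case using swap[OF step.hyps(2) step.IH] by simp
  qed (rule last)
  then show ?thesis using ones_plus_unit_spanning[OF sub] by auto
qed

lemma alpha_in_carrier:
  "Suc i < n \<Longrightarrow> alpha n i \<in> carrier (conj_aut_group n)"
  using alpha_in_conj_auts(1) by (simp add: conj_aut_group_def)

lemma phi_B_alpha_swap:
  assumes \<rho>: "is_rho_B n t \<rho>" and i: "Suc i < n - 1" and w: "w \<in> carrier_vec (n - 1)"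
  shows "phi_B n \<rho> (alpha n i) *\<^sub>v w = vec (n - 1) (\<lambda>r. w $ Transposition.transpose i (Suc i) r)"
proof (rule eq_vecI)
  fix r assume "r < dim_vec (vec (n - 1) (\<lambda>r. w $ Transposition.transpose i (Suc i) r))"
  then have r: "r < n - 1" by simp
  let ?\<tau> = "Transposition.transpose i (Suc i)"
  have "?\<tau> r < n - 1" using r i by (auto simp: Transposition.transpose_def)
  moreover have "r = ?\<tau> c \<longleftrightarrow> c = ?\<tau> r" for c by (auto simp: Transposition.transpose_def)
  ultimately show "(phi_B n \<rho> (alpha n i) *\<^sub>v w) $ r = vec (n - 1) (\<lambda>r. w $ ?\<tau> r) $ r"
    using r i w phi_B_alpha[OF \<rho>, of i]
    by (simp add: scalar_prod_def atLeast0LessThan if_distrib[of "\<lambda>x. x * _"] cong: if_cong)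
qed (use phi_B_carrier[of n \<rho>] in auto)

text \<open>
  The last transposition exchanges \<open>e\<^sub>i\<close> with the omitted basis vector, whose class is
  \<open>- (e\<^sub>0 + \<dots> + e\<^sub>i)\<close>.  It therefore negates \<open>u\<^sub>i\<close> and moves every vector by a multiple of \<open>u\<^sub>i\<close>.
\<close>

lemma phi_B_alpha_last:
  assumes \<rho>: "is_rho_B n t \<rho>" and i: "Suc i = n - 1" and w: "w \<in> carrier_vec (n - 1)"
  shows "phi_B n \<rho> (alpha n i) *\<^sub>v w
    = w - w $ i \<cdot>\<^sub>v ones_plus_unit (n - 1) i"
proof (rule eq_vecI)
  fix r assume "r < dim_vec (w - w $ i \<cdot>\<^sub>v ones_plus_unit (n - 1) i)"
  then have r: "r < n - 1" by (simp add: ones_plus_unit_def)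
  have "(phi_B n \<rho> (alpha n i) *\<^sub>v w) $ r
      = (\<Sum>c<n - 1. (if c = i then - 1 else if r = c then 1 else 0) * w $ c)"
    using r i w phi_B_alpha[OF \<rho>, of i] by (simp add: scalar_prod_def atLeast0LessThan)
  also have "\<dots> = (\<Sum>c<n - 1. if c = i then - (w $ i) else 0)
      + (\<Sum>c<n - 1. if c = r then (if r = i then 0 else w $ r) else 0)"
    unfolding sum.distrib[symmetric] by (rule sum.cong) auto
  also have "\<dots> = - (w $ i) + (if r = i then 0 else w $ r)"
    using r i by simp
  finally show "(phi_B n \<rho> (alpha n i) *\<^sub>v w) $ r
      = (w - w $ i \<cdot>\<^sub>v ones_plus_unit (n - 1) i) $ r"
    using r w by (simp add: ones_plus_unit_def)
qed (use phi_B_carrier[of n \<rho>] in \<open>auto simp: ones_plus_unit_def\<close>)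

theorem theorem7:
  fixes n :: nat and t :: complex
    and \<rho> :: "(letter list \<Rightarrow> letter list) \<Rightarrow> complex mat"
  assumes "n \<ge> 2" and "t \<noteq> 0" and "is_rho_B n t \<rho>"
  shows "irreducible_rep (conj_aut_group n) (n - 1) (phi_B n \<rho>)"
  unfolding irreducible_rep_def
proof (intro allI impI, elim conjE)
  fix W
  assume sub: "VectorSpace.subspace class_ring W (module_vec TYPE(complex) (n - 1))"
    and inv: "\<forall>g\<in>carrier (conj_aut_group n). \<forall>w\<in>W. phi_B n \<rho> g *\<^sub>v w \<in> W"
  define l where "l = n - 2"
  have l: "n - 1 = Suc l" using \<open>n \<ge> 2\<close> by (simp add: l_def)
  have alpha: "phi_B n \<rho> (alpha n i) *\<^sub>v w \<in> W" "w \<in> carrier_vec (n - 1)"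
    if "i \<le> l" "w \<in> W" for i w
    using that inv l alpha_in_carrier[of i n] subspace_module_vecD(1)[OF sub] by auto
  show "W = {0\<^sub>v (n - 1)} \<or> W = carrier_vec (n - 1)"
    unfolding l
  proof (rule swaps_and_reflection_irreducible)
    show "VectorSpace.subspace class_ring W (module_vec TYPE(complex) (Suc l))"
      using sub unfolding l .
    show "vec (Suc l) (\<lambda>r. w $ Transposition.transpose i (Suc i) r) \<in> W"
      if "i < l" "w \<in> W" for i w
      using alpha[of i w] phi_B_alpha_swap[OF \<open>is_rho_B n t \<rho>\<close>, of i w] that l by simp
    show "w - w $ l \<cdot>\<^sub>v ones_plus_unit (Suc l) l \<in> W" if "w \<in> W" for w
      using alpha[of l w] phi_B_alpha_last[OF \<open>is_rho_B n t \<rho>\<close>, of l w] that l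
      by simp
  qed
qed

end
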